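(* Let $\lambda$ be a regular uncountable cardinal, let $\mathcal F$ be a system of local filters on $\lambda$, let $\kappa\le\lambda$, and let $H\subseteq\mathbb{Q}^*_\lambda(\mathcal F)$ be a $({<}\kappa)$-directed family (with respect to $\leq^*$) such that $\mathrm{fil}(H)$ is an ultrafilter on $\lambda$. If $\mathrm{fil}(H)$ is not weakly reasonable, then for some club $C^*$ of $\lambda$ the quotient ultrafilter $\mathrm{fil}(H)/C^*$ is $({<}\kappa)$-complete and contains all clubs of $\lambda$.
   Context: A system of local filters on $\lambda$ is a family $\mathcal{F}$ of triples $(\alpha,Z,F)$ with $Z\subseteq\lambda$, $|Z|<\lambda$, $\alpha=\min(Z)$, $F$ a proper filter on $Z$, such that the set of first coordinates of members of $\mathcal F$ is unbounded in $\lambda$. $\mathbb{Q}^*_\lambda(\mathcal{F})$ is the family of all $r\subseteq\mathcal{F}$ with $|r|=\lambda$ and, for every $\xi<\lambda$, fewer than $\lambda$ triples in $r$ with first coordinate $\xi$. For $r\in\mathbb{Q}^*_\lambda(\mathcal F)$, $\mathrm{fil}(r)=\{A\subseteq\lambda:\exists\varepsilon<\lambda\ \forall(\alpha,Z,F)\in r\ (\varepsilon\le\alpha\Rightarrow A\cap Z\in F)\}$; $r_1\le^* r_2$ iff $\mathrm{fil}(r_1)\subseteq\mathrm{fil}(r_2)$; for $H\subseteq\mathbb{Q}^*_\lambda(\mathcal F)$, $\mathrm{fil}(H)=\bigcup_{r\in H}\mathrm{fil}(r)$. $H$ is $({<}\kappa)$-directed if every subset of $H$ of size $<\kappa$ has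 a $\le^*$-upper bound in $H$. A uniform ultrafilter $D$ on $\lambda$ is weakly reasonable if for every non-decreasing unbounded $f:\lambda\to\lambda$ there is a club $C$ of $\lambda$ with $\bigcup\{[\delta,\delta+f(\delta)):\delta\in C\}\notin D$. For an ultrafilter $D$ on $\lambda$ and a club $C\subseteq\lambda$, letting $\langle\delta_\xi:\xi<\lambda\rangle$ be the increasing enumeration of $C\cup\{0\}$, $D/C=\{A\subseteq\lambda:\bigcup_{\xi\in A}[\delta_\xi,\delta_{\xi+1})\in D\}$. *)

theory Defs
  imports Main
begin

unbundle cardinal_syntax

text \<open>
  The cardinal \<open>\<lambda>\<close> is the well-ordered type \<open>'a\<close>: the ordinals below \<open>\<lambda>\<close> are the elements of \<open>'a\<close>,
  and subsets of \<open>\<lambda>\<close> are terms of type \<open>'a set\<close>.  That \<open>'a\<close> is a cardinal, regular or uncountable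
  is expressed by applying the library's notions to \<open>ord_rel\<close>.
\<close>

definition ord_rel :: "'a::wellorder rel" where
  "ord_rel = {(x, y). x \<le> y}"

definition ord_zero :: "'a::wellorder" where
  "ord_zero = (LEAST x. True)"

definition ord_succ :: "'a::wellorder \<Rightarrow> 'a" where
  "ord_succ x = (LEAST y. x < y)"

text \<open>
  Ordinal addition by transfinite recursion on the second argument:
  \<open>a + b\<close> is the least \<open>c \<ge> a\<close> lying strictly above \<open>a + b'\<close> for all \<open>b' < b\<close>.
\<close>

function ord_add :: "'a::wellorder \<Rightarrow> 'a \<Rightarrow> 'a" where
  "ord_add a b = (LEAST c. a \<le> c \<and> (\<forall>b'. b' < b \<longrightarrow> ord_add a b' < c))"
  by pat_completeness auto
termination
  by (relation "inv_image {(x, y). x < y} snd") (auto intro: wf_inv_image wf)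

declare ord_add.simps [simp del]

definition unbounded :: "'a::wellorder set \<Rightarrow> bool" where
  "unbounded S \<longleftrightarrow> (\<forall>b. \<exists>a\<in>S. b \<le> a)"

text \<open>
  The premise on \<open>d\<close> says that \<open>d\<close> is a limit ordinal and \<open>C \<inter> d\<close> is unbounded in \<open>d\<close>.
\<close>

definition club :: "'a::wellorder set \<Rightarrow> bool" where
  "club C \<longleftrightarrow> unbounded C \<and>
     (\<forall>d. d \<noteq> ord_zero \<and> (\<forall>x<d. \<exists>c\<in>C. x < c \<and> c < d) \<longrightarrow> d \<in> C)"

definition proper_filter_on :: "'a set \<Rightarrow> 'a set set \<Rightarrow> bool" where
  "proper_filter_on Z F \<longleftrightarrow> F \<subseteq> Pow Z \<and> Z \<in> F \<and> {} \<notin> F \<and>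
     (\<forall>A\<in>F. \<forall>B\<in>F. A \<inter> B \<in> F) \<and> (\<forall>A\<in>F. \<forall>B. A \<subseteq> B \<and> B \<subseteq> Z \<longrightarrow> B \<in> F)"

definition ultrafilter_on :: "'a set \<Rightarrow> 'a set set \<Rightarrow> bool" where
  "ultrafilter_on Z D \<longleftrightarrow> proper_filter_on Z D \<and> (\<forall>A\<subseteq>Z. A \<in> D \<or> Z - A \<in> D)"

definition uniform_ultrafilter :: "'a set set \<Rightarrow> bool" where
  "uniform_ultrafilter D \<longleftrightarrow> ultrafilter_on UNIV D \<and> (\<forall>A\<in>D. |A| =o |UNIV :: 'a set| )"

type_synonym 'a local_filter = "'a \<times> 'a set \<times> 'a set set"

definition local_filter_system :: "'a::wellorder local_filter set \<Rightarrow> bool" where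
  "local_filter_system \<F> \<longleftrightarrow>
     (\<forall>(\<alpha>, Z, F)\<in>\<F>. Z \<noteq> {} \<and> |Z| <o |UNIV :: 'a set| \<and> \<alpha> = (LEAST z. z \<in> Z)
        \<and> proper_filter_on Z F) \<and>
     unbounded (fst ` \<F>)"

definition Qstar :: "'a::wellorder local_filter set \<Rightarrow> 'a local_filter set set" where
  "Qstar \<F> = {r. r \<subseteq> \<F> \<and> |r| =o |UNIV :: 'a set| \<and>
     (\<forall>\<xi>. |{t \<in> r. fst t = \<xi>}| <o |UNIV :: 'a set| )}"

definition fil :: "'a::wellorder local_filter set \<Rightarrow> 'a set set" where
  "fil r = {A. \<exists>\<epsilon>. \<forall>(\<alpha>, Z, F)\<in>r. \<epsilon> \<le> \<alpha> \<longrightarrow> A \<inter> Z \<in> F}"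

definition le_star :: "'a::wellorder local_filter set \<Rightarrow> 'a local_filter set \<Rightarrow> bool"
    (infix \<open>\<le>\<^sup>*\<close> 50) where
  "r1 \<le>\<^sup>* r2 \<longleftrightarrow> fil r1 \<subseteq> fil r2"

definition fil_family :: "'a::wellorder local_filter set set \<Rightarrow> 'a set set" where
  "fil_family H = (\<Union>r\<in>H. fil r)"

definition lt_directed :: "'b rel \<Rightarrow> 'a::wellorder local_filter set set \<Rightarrow> bool" where
  "lt_directed \<kappa> H \<longleftrightarrow> (\<forall>X\<subseteq>H. |X| <o \<kappa> \<longrightarrow> (\<exists>s\<in>H. \<forall>r\<in>X. r \<le>\<^sup>* s))"

definition lt_complete :: "'b rel \<Rightarrow> 'a set set \<Rightarrow> bool" where
  "lt_complete \<kappa> D \<longleftrightarrow> (\<forall>\<A>\<subseteq>D. |\<A>| <o \<kappa> \<longrightarrow> \<Inter>\<A> \<in> D)"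

definition weakly_reasonable :: "'a::wellorder set set \<Rightarrow> bool" where
  "weakly_reasonable D \<longleftrightarrow> uniform_ultrafilter D \<and>
     (\<forall>f :: 'a \<Rightarrow> 'a. mono f \<and> unbounded (range f) \<longrightarrow>
        (\<exists>C. club C \<and> (\<Union>\<delta>\<in>C. {\<delta>..<ord_add \<delta> (f \<delta>)}) \<notin> D))"

text \<open>
  When \<open>\<lambda>\<close> is regular, every unbounded \<open>S\<close> has order type \<open>\<lambda>\<close>, so the enumeration is
  indexed by all of \<open>'a\<close>.
\<close>

definition increasing_enum :: "'a::wellorder set \<Rightarrow> 'a \<Rightarrow> 'a" where
  "increasing_enum S = (THE e. strict_mono e \<and> range e = S)"

definition quotient_filter :: "'a::wellorder set set \<Rightarrow> 'a set \<Rightarrow> 'a set set" where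
  "quotient_filter D C =
     (let \<delta> = increasing_enum (C \<union> {ord_zero})
      in {A. (\<Union>\<xi>\<in>A. {\<delta> \<xi>..<\<delta> (ord_succ \<xi>)}) \<in> D})"

end

theory Submission imports Defs begin

text \<open>
  Let \<open>f\<close> witness that \<open>D = fil(H)\<close> is not weakly reasonable and let \<open>C\<^sup>*\<close> be the club of points closed
  under \<open>\<delta> \<mapsto> \<delta> + f \<delta>\<close>.  Then \<open>[\<delta>, \<delta> + f \<delta>)\<close> stays inside the block of \<open>C\<^sup>*\<close> that starts at \<open>\<delta>\<close>,
  so every club belongs to \<open>D/C\<^sup>*\<close>.  For completeness, directedness gives one \<open>s \<in> H\<close> such that
  \<open>fil(s)\<close> contains the block unions of all the given sets \<open>A\<^sub>i\<close>.  Thin out \<open>C\<^sup>*\<close> to points \<open>\<delta>\<close>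
  such that every \<open>Z\<close> from \<open>s\<close> starting below \<open>\<delta>\<close> stays below \<open>\<delta>\<close>: then each \<open>Z\<close> meets at most one of the
  blocks starting at the remaining points.  If \<open>\<Inter>A\<^sub>i\<close> were not in \<open>D/C\<^sup>*\<close>, then for some
  \<open>(\<alpha>, Z, F) \<in> s\<close> the union of the remaining blocks with index outside \<open>\<Inter>A\<^sub>i\<close> would be \<open>F\<close>-positive,
  hence so would a single block; as this block meets the block union of every \<open>A\<^sub>i\<close>, its index
  lies in every \<open>A\<^sub>i\<close>.
\<close>

section \<open>Order preliminaries and uniqueness of increasing enumerations\<close>

lemma Field_ord_rel: "Field (ord_rel :: 'a::wellorder rel) = UNIV"
  unfolding ord_rel_def Field_def by auto

lemma ord_zero_le: "ord_zero \<le> (x::'a::wellorder)"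
  unfolding ord_zero_def by (rule Least_le) simp

text \<open>No limit condition is imposed, and \<open>ord_zero\<close> is a member
  vacuously.\<close>

definition closure_points :: "('a::wellorder \<Rightarrow> 'a) \<Rightarrow> 'a set" where
  "closure_points g = {d. \<forall>x<d. g x < d}"

lemma le_strict_mono:
  fixes e :: "'a::wellorder \<Rightarrow> 'a"
  assumes "strict_mono e"
  shows "x \<le> e x"
proof (induction x rule: less_induct)
  case (less x)
  show ?case
  proof (rule ccontr)
    assume "\<not> x \<le> e x"
    then have "e x < x" by simp
    then have "e (e x) < e x" using assms by (simp add: strict_mono_less)
    then show False using less[OF \<open>e x < x\<close>] by simp
  qed
qed

lemma ord_zero_in_closure_points: "ord_zero \<in> closure_points g"
  unfolding closure_points_def using ord_zero_le leD by blast

text \<open>At the least index of disagreement, the smaller of the two values would have to occur in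
  the other enumeration at an earlier index, where both still agree.\<close>

lemma increasing_enum_unique:
  fixes e e' :: "'a::wellorder \<Rightarrow> 'a"
  assumes "strict_mono e" "strict_mono e'" "range e = range e'"
  shows "e = e'"
proof
  fix x
  show "e x = e' x"
  proof (induction x rule: less_induct)
    case (less x)
    have aux: "\<not> u x < v x"
      if u: "strict_mono u" "strict_mono v" "range u = range v" "\<And>y. y < x \<Longrightarrow> u y = v y"
      for u v :: "'a \<Rightarrow> 'a"
    proof
      assume lt: "u x < v x"
      obtain z where z: "u x = v z"
        using u(3) by (metis rangeE rangeI)
      with lt have "z < x" using u(2) by (simp add: strict_mono_less)
      then have "u x = u z" using u(4) z by simp
      then show False using \<open>z < x\<close> u(1) by (simp add: strict_mono_eq)
    qed
    show ?case
      using aux[of e e'] aux[of e' e] assms less by (metis linorder_neqE)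
  qed
qed

section \<open>Local filters and \<open>fil\<close>\<close>

lemma proper_filter_onD:
  assumes "proper_filter_on Z F"
  shows "Z \<in> F" "{} \<notin> F" "\<And>A B. A \<in> F \<Longrightarrow> B \<in> F \<Longrightarrow> A \<inter> B \<in> F"
    "\<And>A B. A \<in> F \<Longrightarrow> A \<subseteq> B \<Longrightarrow> B \<subseteq> Z \<Longrightarrow> B \<in> F"
  using assms unfolding proper_filter_on_def by blast+

lemma fil_eventually:
  assumes "A \<in> fil r"
  shows "\<exists>\<epsilon>. \<forall>\<alpha> Z F. (\<alpha>, Z, F) \<in> r \<longrightarrow> \<epsilon> \<le> \<alpha> \<longrightarrow> A \<inter> Z \<in> F"
  using assms unfolding fil_def by blast

lemma fil_eventually_nonempty:
  assumes "local_filter_system \<F>" "r \<subseteq> \<F>" "A \<in> fil r"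
  obtains \<epsilon> where "\<And>\<alpha> Z F. (\<alpha>, Z, F) \<in> r \<Longrightarrow> \<epsilon> \<le> \<alpha> \<Longrightarrow> A \<inter> Z \<noteq> {}"
proof -
  obtain \<epsilon> where \<epsilon>: "\<And>\<alpha> Z F. (\<alpha>, Z, F) \<in> r \<Longrightarrow> \<epsilon> \<le> \<alpha> \<Longrightarrow> A \<inter> Z \<in> F"
    using fil_eventually[OF assms(3)] by blast
  have "proper_filter_on Z F" if "(\<alpha>, Z, F) \<in> r" for \<alpha> Z F
    using that assms(1,2) unfolding local_filter_system_def by blast
  then show ?thesis
    using \<epsilon> that proper_filter_onD(2) by metis
qed

lemma local_filter_min:
  assumes "local_filter_system \<F>" "(\<alpha>, Z, F) \<in> \<F>" "z \<in> Z"
  shows "\<alpha> \<le> z"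
proof -
  have "\<alpha> = (LEAST z. z \<in> Z)"
    using assms(1,2) unfolding local_filter_system_def by blast
  then show ?thesis using assms(3) by (simp add: Least_le)
qed

text \<open>Otherwise the complement of \<open>X\<close> would belong to \<open>fil s\<close>, hence
  to the proper filter that contains \<open>X\<close>.\<close>

lemma fil_positive:
  assumes "s \<in> H" "proper_filter_on UNIV (fil_family H)"
    "X \<in> fil_family H"
  obtains \<alpha> Z F where "(\<alpha>, Z, F) \<in> s" "\<epsilon> \<le> \<alpha>" "Z - X \<notin> F"
proof (rule ccontr)
  assume "\<not> thesis"
  then have "UNIV - X \<in> fil s"
    unfolding fil_def using that by (auto simp: Diff_Int_distrib2 Diff_Int intro!: exI[of _ \<epsilon>])
  then have "(UNIV - X) \<inter> X \<in> fil_family H"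
    using proper_filter_onD(3)[OF assms(2)] assms(1,3) unfolding fil_family_def by blast
  then show False using proper_filter_onD(2)[OF assms(2)] by (simp add: Diff_Int_distrib2)
qed

section \<open>Regularity of \<lambda>: small sets are bounded\<close>

context
  assumes card: "Card_order (ord_rel :: 'a::wellorder rel)"
    and reg: "regularCard (ord_rel :: 'a rel)"
    and unc: "natLeq <o (ord_rel :: 'a rel)"
begin

lemma card_UNIV_ordIso: "|UNIV :: 'a set| =o (ord_rel :: 'a rel)"
  using card_of_Field_ordIso[OF card] by (simp add: Field_ord_rel)

lemma ordLess_UNIV_iff: "r <o |UNIV :: 'a set| \<longleftrightarrow> r <o (ord_rel :: 'a rel)"
  using card_UNIV_ordIso ordIso_symmetric ordLess_ordIso_trans by blast

lemma Cinfinite_ord_rel: "Cinfinite (ord_rel :: 'a rel)"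
  using card cinfinite_mono[OF ordLess_imp_ordLeq[OF unc]] natLeq_Cinfinite by blast

lemma ex_greater: "\<exists>y. (x::'a) < y"
proof -
  have "infinite (Field (ord_rel :: 'a rel))"
    using Cinfinite_ord_rel by (simp add: cinfinite_def)
  from infinite_Card_order_limit[OF card this, of x]
  obtain y where "x \<noteq> y" "(x, y) \<in> ord_rel" by (auto simp: Field_ord_rel)
  then show ?thesis by (auto simp: ord_rel_def less_le)
qed

lemma small_bounded:
  assumes "|A :: 'a set| <o |UNIV :: 'a set|"
  obtains b where "\<And>a. a \<in> A \<Longrightarrow> a < b"
proof (rule ccontr)
  assume "\<not> thesis"
  then have nb: "\<exists>a\<in>A. b \<le> a" for b
    using that by (meson not_le)
  have "cofinal A (ord_rel :: 'a rel)"
    unfolding cofinal_def Field_ord_rel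
  proof
    fix a :: 'a
    \<comment> \<open>\<open>cofinal\<close> asks for an element strictly above \<open>a\<close>, so
      \<open>nb\<close> is applied to a larger \<open>c\<close>.\<close>
    obtain c where "a < c" using ex_greater by blast
    moreover obtain d where "d \<in> A" "c \<le> d" using nb by blast
    ultimately show "\<exists>b\<in>A. a \<noteq> b \<and> (a, b) \<in> ord_rel"
      by (intro bexI[of _ d]) (auto simp: ord_rel_def)
  qed
  then have "|A| =o (ord_rel :: 'a rel)"
    using reg unfolding regularCard_def Field_ord_rel by blast
  then show False
    using assms not_ordLess_ordIso ordLess_UNIV_iff by blast
qed

lemma small_lessThan: "|{..<x :: 'a}| <o |UNIV :: 'a set|"
proof -
  have "{..<x} = underS ord_rel x"
    unfolding underS_def ord_rel_def by auto
  then show ?thesis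
    using card_of_underS[OF card, of x] by (simp add: Field_ord_rel ordLess_UNIV_iff)
qed

lemma small_UNION:
  assumes "|I| <o |UNIV :: 'a set|" "\<And>i. i \<in> I \<Longrightarrow> |A i| <o |UNIV :: 'a set|"
  shows "|\<Union>i\<in>I. A i| <o |UNIV :: 'a set|"
  using assms unfolding ordLess_UNIV_iff
  by (rule regularCard_UNION_bound[OF Cinfinite_ord_rel reg])

lemma image_bounded:
  fixes h :: "'i \<Rightarrow> 'a"
  assumes "|I| <o |UNIV :: 'a set|"
  obtains b where "\<And>i. i \<in> I \<Longrightarrow> h i < b"
proof -
  have "|h ` I| <o |UNIV :: 'a set|"
    using assms card_of_image ordLeq_ordLess_trans by blast
  then show ?thesis using that small_bounded by (metis imageI)
qed

section \<open>Clubs of closure points and their enumerations\<close>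

lemma club_closure_points:
  fixes g :: "'a \<Rightarrow> 'a"
  shows "club (closure_points g)"
proof -
  have "\<exists>d\<in>closure_points g. b \<le> d" for b
  proof -
    \<comment> \<open>One step of the iteration: regularity bounds \<open>g\<close> on the initial
      segment below \<open>y\<close>.\<close>
    have "\<exists>z. y < z \<and> (\<forall>x<y. g x < z)" for y
    proof -
      obtain z1 where z1: "\<And>x. x \<in> {..<y} \<Longrightarrow> g x < z1"
        using image_bounded[OF small_lessThan] by blast
      obtain z2 where "y < z2" using ex_greater by blast
      then show ?thesis using z1 by (intro exI[of _ "max z1 z2"]) (auto simp: less_max_iff_disj)
    qed
    then obtain h where h: "\<And>y. y < h y" "\<And>x y. x < y \<Longrightarrow> g x < h y"
      by metis
    define u where "u n = (h ^^ n) b" for n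
    \<comment> \<open>Countably many iterates are bounded because \<lambda> is regular and
      uncountable.\<close>
    have "|UNIV :: nat set| <o |UNIV :: 'a set|"
      using unc card_of_nat ordIso_ordLess_trans ordLess_UNIV_iff by blast
    then obtain c where c: "\<And>n. u n < c"
      using image_bounded by (metis UNIV_I)
    \<comment> \<open>The supremum of the iterates: any \<open>x < d\<close> lies below some
      \<open>u n\<close>, whence \<open>g x < u (Suc n)\<close>, which is at most
      \<open>d\<close>.\<close>
    define d where "d = (LEAST d. \<forall>n. u n \<le> d)"
    have le: "u n \<le> d" for n
      using LeastI[of "\<lambda>d. \<forall>n. u n \<le> d" c] c unfolding d_def by (simp add: less_imp_le)
    have "g x < d" if "x < d" for x
    proof -
      have "\<not> (\<forall>n. u n \<le> x)"
        using not_less_Least[of x "\<lambda>d. \<forall>n. u n \<le> d"] that unfolding d_def[symmetric] .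
      then obtain n where "x < u n" by (meson not_le)
      then have "g x < u (Suc n)" using h(2) by (simp add: u_def)
      then show ?thesis using le less_le_trans by blast
    qed
    moreover have "b \<le> d" using le[of 0] by (simp add: u_def)
    ultimately show ?thesis unfolding closure_points_def by blast
  qed
  then show ?thesis
    unfolding club_def unbounded_def closure_points_def
    by simp (meson order.strict_trans)
qed

text \<open>Recursively take the least element of \<open>S\<close> above all earlier values. It
  exists because there are fewer than \<lambda> earlier values, so they are bounded, and
  \<open>S\<close> is unbounded.\<close>

lemma increasing_enum_props:
  fixes S :: "'a set"
  assumes "unbounded S"
  shows "strict_mono (increasing_enum S)" "range (increasing_enum S) = S"
proof -
  define P where "P f x r \<longleftrightarrow> r = (LEAST y. y \<in> S \<and> (\<forall>x'<x. f x' < y))" for f and x r :: 'a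
  have "\<exists>e. \<forall>x. P e x (e x)"
    by (rule dependent_wellorder_choice) (auto simp: P_def cong: conj_cong)
  then obtain e where "\<forall>x. P e x (e x)" ..
  then have e: "e x = (LEAST y. y \<in> S \<and> (\<forall>x'<x. e x' < y))" for x
    unfolding P_def by (rule spec)
  have ex: "\<exists>y. y \<in> S \<and> (\<forall>x'<x. e x' < y)" for x
  proof -
    obtain b where "\<And>x'. x' \<in> {..<x} \<Longrightarrow> e x' < b"
      using image_bounded[OF small_lessThan] by blast
    moreover obtain y where "y \<in> S" "b \<le> y" using assms unfolding unbounded_def by blast
    ultimately show ?thesis by (meson lessThan_iff less_le_trans)
  qed
  have eS: "e x \<in> S \<and> (\<forall>x'<x. e x' < e x)" for x
    using LeastI_ex[OF ex[of x]] unfolding e[of x, symmetric] .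
  have mono: "strict_mono e" using eS by (auto simp: strict_mono_def)
  have "range e = S"
  proof
    show "range e \<subseteq> S" using eS by blast
    show "S \<subseteq> range e"
    proof
      fix y assume y: "y \<in> S"
      \<comment> \<open>Such an index exists since \<open>y \<le> e y\<close>. All earlier values
        are below \<open>y\<close>, so \<open>y\<close> itself is a candidate for the minimum that
        defines \<open>e x\<close>.\<close>
      define x where "x = (LEAST x. y \<le> e x)"
      have "y \<le> e x" unfolding x_def by (rule LeastI[of _ y]) (rule le_strict_mono[OF mono])
      moreover have "e x' < y" if "x' < x" for x'
        using not_less_Least that unfolding x_def by (meson not_le)
      then have "e x \<le> y" using y by (subst e) (auto intro!: Least_le)
      ultimately show "y \<in> range e" by (metis antisym rangeI)
    qed
  qed
  then have "strict_mono (increasing_enum S) \<and> range (increasing_enum S) = S"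
    unfolding increasing_enum_def
    by (intro theI[of "\<lambda>e. strict_mono e \<and> range e = S" e])
      (auto intro: increasing_enum_unique mono)
  then show "strict_mono (increasing_enum S)" "range (increasing_enum S) = S" by auto
qed

section \<open>Blocks between consecutive points of a club\<close>

lemma less_ord_succ: "(x::'a) < ord_succ x"
  unfolding ord_succ_def using ex_greater LeastI_ex by metis

lemma ord_succ_le: "(x::'a) < y \<Longrightarrow> ord_succ x \<le> y"
  unfolding ord_succ_def by (rule Least_le)

text \<open>The next closure point lies above \<open>e \<xi>\<close> and is closed under
  \<open>g\<close>.\<close>

lemma closure_points_block:
  fixes e :: "'a \<Rightarrow> 'a"
  assumes "strict_mono e" "range e = closure_points g"
  shows "g (e \<xi>) < e (ord_succ \<xi>)"
proof -
  have "e (ord_succ \<xi>) \<in> closure_points g" using assms(2) by blast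
  then show ?thesis
    using less_ord_succ strict_mono_less[OF assms(1)] by (auto simp: closure_points_def)
qed

text \<open>A limit of the image is some \<open>e x\<close> because the range is closed, and strict
  monotonicity makes \<open>x\<close> a limit of \<open>E\<close>.\<close>

lemma club_image_enum:
  fixes e :: "'a \<Rightarrow> 'a"
  assumes "strict_mono e" "club (range e)" "club E"
  shows "club (e ` E)"
  unfolding club_def
proof (intro conjI allI impI)
  show "unbounded (e ` E)"
    using assms(3) le_strict_mono[OF assms(1)] unfolding club_def unbounded_def
    by (meson imageI order_trans)
next
  fix d assume d: "d \<noteq> ord_zero \<and> (\<forall>x<d. \<exists>c\<in>e ` E. x < c \<and> c < d)"
  then have "d \<in> range e"
    using assms(2) unfolding club_def by blast
  then obtain x where x: "d = e x" by blast
  have lim: "\<exists>c\<in>E. x' < c \<and> c < x" if "x' < x" for x'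
    using d that strict_mono_less[OF assms(1)] unfolding x by blast
  \<comment> \<open>Closedness of \<open>E\<close> speaks of nonzero points, so an index below
    \<open>x\<close> has to be exhibited.\<close>
  have "ord_zero < d" using d ord_zero_le le_neq_trans by metis
  then obtain c where "e c < e x" using d unfolding x by blast
  then have "c < x" using strict_mono_less[OF assms(1)] by blast
  then have "x \<noteq> ord_zero" using ord_zero_le leD by blast
  then have "x \<in> E" using assms(3) lim unfolding club_def by blast
  then show "d \<in> e ` E" using x by blast
qed

text \<open>The block starts at the supremum \<open>m\<close> of the points of the range up to
  \<open>y\<close>. If \<open>m\<close> were not attained, it would be a limit of the range, against
  closedness; the assumption on \<open>ord_zero\<close> covers the degenerate case
  \<open>m = ord_zero\<close>.\<close>

lemma ex_block:
  fixes e :: "'a \<Rightarrow> 'a"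
  assumes "strict_mono e" "club (range e)" "ord_zero \<in> range e"
  obtains \<xi> where "e \<xi> \<le> y" "y < e (ord_succ \<xi>)"
proof -
  let ?ub = "\<lambda>m. \<forall>s\<in>range e. s \<le> y \<longrightarrow> s \<le> m"
  define m where "m = (LEAST m. ?ub m)"
  have "?ub m" unfolding m_def by (rule LeastI[of ?ub y]) blast
  have "m \<le> y" unfolding m_def by (rule Least_le) blast
  have below: "\<exists>s\<in>range e. s \<le> y \<and> x < s" if "x < m" for x
    using not_less_Least[of x ?ub] that unfolding m_def[symmetric] by (meson not_le)
  have "m \<in> range e"
  proof (rule ccontr)
    assume m: "m \<notin> range e"
    have "\<exists>c\<in>range e. x < c \<and> c < m" if "x < m" for x
      using below[OF that] \<open>?ub m\<close> m by (metis le_less)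
    moreover have "m \<noteq> ord_zero" using m assms(3) by blast
    ultimately show False using m assms(2) unfolding club_def by blast
  qed
  then obtain \<xi> where \<xi>: "m = e \<xi>" by blast
  have "e \<xi> < e (ord_succ \<xi>)"
    using less_ord_succ strict_mono_less[OF assms(1)] by blast
  then have "y < e (ord_succ \<xi>)"
    using \<open>?ub m\<close> \<xi> by (meson leD not_le rangeI)
  then show ?thesis using that \<open>m \<le> y\<close> \<xi> by blast
qed

lemma block_index_unique:
  fixes e :: "'a \<Rightarrow> 'a"
  assumes "strict_mono e" "y \<in> {e \<xi>..<e (ord_succ \<xi>)}" "y \<in> {e \<eta>..<e (ord_succ \<eta>)}"
  shows "\<xi> = \<eta>"
proof -
  have "\<not> \<xi> < \<eta>" if "y \<in> {e \<xi>..<e (ord_succ \<xi>)}" "y \<in> {e \<eta>..<e (ord_succ \<eta>)}" for \<xi> \<eta>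
  proof
    assume "\<xi> < \<eta>"
    then have "e (ord_succ \<xi>) \<le> e \<eta>"
      using ord_succ_le strict_mono_less_eq[OF assms(1)] by blast
    then show False using that by auto
  qed
  then show ?thesis using assms(2,3) by (metis linorder_neqE)
qed

text \<open>The blocks partition \<lambda>, so taking block unions respects intersections,
  complements and inclusions, and the ultrafilter laws pull back.\<close>

lemma ultrafilter_quotient:
  fixes e :: "'a \<Rightarrow> 'a"
  assumes "strict_mono e" "club (range e)" "ord_zero \<in> range e" "ultrafilter_on UNIV D"
  shows "ultrafilter_on UNIV {A. (\<Union>\<xi>\<in>A. {e \<xi>..<e (ord_succ \<xi>)}) \<in> D}"
proof -
  let ?U = "\<lambda>A. \<Union>\<xi>\<in>A. {e \<xi>..<e (ord_succ \<xi>)}"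
  have pf: "proper_filter_on UNIV D" and ult: "\<And>A. A \<in> D \<or> UNIV - A \<in> D"
    using assms(4) unfolding ultrafilter_on_def by auto
  have U_UNIV: "?U UNIV = UNIV"
    using ex_block[OF assms(1-3)] by (auto simp: atLeastLessThan_iff) metis
  have U_Int: "?U (A \<inter> B) = ?U A \<inter> ?U B" for A B
    using block_index_unique[OF assms(1)] by blast
  have U_Diff: "?U (UNIV - A) = UNIV - ?U A" for A
  proof -
    have "?U (UNIV - A) \<union> ?U A = UNIV" using U_UNIV by (metis UN_Un Compl_eq_Diff_UNIV Compl_partition2)
    moreover have "?U (UNIV - A) \<inter> ?U A = {}" using U_Int[of "UNIV - A" A] by (metis Diff_disjoint Int_commute UN_empty)
    ultimately show ?thesis by blast
  qed
  have U_mono: "A \<subseteq> B \<Longrightarrow> ?U A \<subseteq> ?U B" for A B by blast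
  show ?thesis
    unfolding ultrafilter_on_def proper_filter_on_def
  proof (intro conjI ballI allI impI)
    show "{} \<notin> {A. ?U A \<in> D}" using proper_filter_onD(2)[OF pf] by simp
    show "UNIV \<in> {A. ?U A \<in> D}" using proper_filter_onD(1)[OF pf] U_UNIV by simp
    show "A \<inter> B \<in> {A. ?U A \<in> D}" if "A \<in> {A. ?U A \<in> D}" "B \<in> {A. ?U A \<in> D}" for A B
      using that proper_filter_onD(3)[OF pf] unfolding mem_Collect_eq U_Int by blast
    show "B \<in> {A. ?U A \<in> D}" if "A \<in> {A. ?U A \<in> D}" "A \<subseteq> B \<and> B \<subseteq> UNIV" for A B
      using that proper_filter_onD(4)[OF pf _ U_mono] unfolding mem_Collect_eq by blast
    show "A \<in> {A. ?U A \<in> D} \<or> UNIV - A \<in> {A. ?U A \<in> D}" for A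
      using ult unfolding mem_Collect_eq U_Diff by blast
  qed simp
qed

section \<open>Size and boundedness for members of \<open>Qstar\<close>\<close>

lemma Qstar_unbounded:
  assumes "r \<in> Qstar (\<F> :: 'a local_filter set)"
  obtains \<alpha> Z F where "(\<alpha>, Z, F) \<in> r" "b \<le> \<alpha>"
proof (rule ccontr)
  assume "\<not> thesis"
  \<comment> \<open>Fewer than \<lambda> first coordinates lie below \<open>b\<close>, each with a
    small fibre, so \<open>r\<close> would be small.\<close>
  then have "r = (\<Union>\<xi>\<in>{..<b}. {t \<in> r. fst t = \<xi>})"
    using that by (fastforce simp: not_le)
  moreover have "|\<Union>\<xi>\<in>{..<b}. {t \<in> r. fst t = \<xi>}| <o |UNIV :: 'a set|"
    using assms by (intro small_UNION small_lessThan) (auto simp: Qstar_def)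
  moreover have "|r| =o |UNIV :: 'a set|" using assms by (simp add: Qstar_def)
  ultimately show False using not_ordLess_ordIso by metis
qed

text \<open>A set of smaller size is bounded, whereas the sets \<open>Z\<close> far out in
  \<open>r\<close> lie above the bound and yet must meet \<open>A\<close>.\<close>

lemma fil_family_uniform:
  fixes \<F> :: "'a local_filter set"
  assumes "local_filter_system \<F>" "H \<subseteq> Qstar \<F>" "A \<in> fil_family H"
  shows "|A| =o |UNIV :: 'a set|"
proof (rule ccontr)
  assume "\<not> |A| =o |UNIV :: 'a set|"
  then have "|A| <o |UNIV :: 'a set|"
    using card_of_mono1[OF subset_UNIV] ordLeq_iff_ordLess_or_ordIso by blast
  then obtain b where b: "\<And>a. a \<in> A \<Longrightarrow> a < b" using small_bounded by blast
  obtain r where r: "r \<in> Qstar \<F>" "A \<in> fil r"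
    using assms(2,3) unfolding fil_family_def by blast
  then have sub: "r \<subseteq> \<F>" by (simp add: Qstar_def)
  obtain \<epsilon> where \<epsilon>: "\<And>\<alpha> Z F. (\<alpha>, Z, F) \<in> r \<Longrightarrow> \<epsilon> \<le> \<alpha> \<Longrightarrow> A \<inter> Z \<noteq> {}"
    using fil_eventually_nonempty[OF assms(1) sub r(2)] by blast
  obtain \<alpha> Z F where t: "(\<alpha>, Z, F) \<in> r" "max b \<epsilon> \<le> \<alpha>"
    using Qstar_unbounded[OF r(1)] by blast
  then obtain z where "z \<in> A" "z \<in> Z" using \<epsilon> by fastforce
  then show False
    using b local_filter_min[OF assms(1)] t sub by (meson leD max.boundedE order_trans subsetD)
qed

text \<open>Fewer than \<lambda> triples start at \<alpha> and their sets are small, so the union of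
  these sets is bounded. At a point closed under the resulting \<open>g\<close>, no \<open>Z\<close>
  that starts below reaches the point.\<close>

lemma Qstar_support_bound:
  assumes "local_filter_system \<F>" "s \<in> Qstar (\<F> :: 'a local_filter set)"
  obtains g where "\<And>\<alpha> Z F z. (\<alpha>, Z, F) \<in> s \<Longrightarrow> z \<in> Z \<Longrightarrow> z < g \<alpha>"
proof -
  have "\<exists>b. \<forall>Z F z. (\<alpha>, Z, F) \<in> s \<longrightarrow> z \<in> Z \<longrightarrow> z < b" for \<alpha>
  proof -
    have "|\<Union>t\<in>{t \<in> s. fst t = \<alpha>}. fst (snd t)| <o |UNIV :: 'a set|"
      using assms by (intro small_UNION) (fastforce simp: Qstar_def local_filter_system_def)+
    then obtain b where "\<And>z. z \<in> (\<Union>t\<in>{t \<in> s. fst t = \<alpha>}. fst (snd t)) \<Longrightarrow> z < b"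
      using small_bounded by blast
    then show ?thesis by (intro exI[of _ b]) force
  qed
  then show ?thesis using that by metis
qed

section \<open>Completeness of the quotient, and its clubs\<close>

lemma lt_complete_quotient:
  fixes \<F> :: "'a local_filter set" and \<kappa> :: "'b rel" and e g :: "'a \<Rightarrow> 'a"
  assumes sys: "local_filter_system \<F>" and kle: "\<kappa> \<le>o (ord_rel :: 'a rel)"
    and HQ: "H \<subseteq> Qstar \<F>" and dir: "lt_directed \<kappa> H"
    and ult: "ultrafilter_on UNIV (fil_family H)"
    and big: "\<And>C. club C \<Longrightarrow> (\<Union>\<delta>\<in>C. {\<delta>..<g \<delta>}) \<in> fil_family H"
    and e: "strict_mono e" "range e = closure_points g"
  shows "lt_complete \<kappa> {A. (\<Union>\<xi>\<in>A. {e \<xi>..<e (ord_succ \<xi>)}) \<in> fil_family H}"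
proof -
  let ?D = "fil_family H"
  define U where "U A = (\<Union>\<xi>\<in>A. {e \<xi>..<e (ord_succ \<xi>)})" for A
  have UI: "y \<in> U A \<longleftrightarrow> (\<exists>\<xi>\<in>A. y \<in> {e \<xi>..<e (ord_succ \<xi>)})" for y A
    unfolding U_def by blast
  show ?thesis
    unfolding lt_complete_def U_def[symmetric]
  proof (intro allI impI)
    fix \<A> :: "'a set set"
    assume sub: "\<A> \<subseteq> {A. U A \<in> ?D}" and small: "|\<A>| <o \<kappa>"
    have pf: "proper_filter_on UNIV ?D"
      using ult by (simp add: ultrafilter_on_def)
    have "club (range e)" "ord_zero \<in> range e"
      using club_closure_points ord_zero_in_closure_points by (simp_all add: e)
    note quot = ultrafilter_quotient[OF e(1) this ult, folded U_def]
    \<comment> \<open>Directedness concerns members of \<open>H\<close>, so one member is chosen for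
      each \<open>A\<close>.\<close>
    have "\<forall>A\<in>\<A>. \<exists>r\<in>H. U A \<in> fil r"
      using sub unfolding fil_family_def by blast
    then obtain \<rho> where \<rho>: "\<And>A. A \<in> \<A> \<Longrightarrow> \<rho> A \<in> H \<and> U A \<in> fil (\<rho> A)" by metis
    have "|\<rho> ` \<A>| <o \<kappa>" using small card_of_image ordLeq_ordLess_trans by blast
    moreover have "\<rho> ` \<A> \<subseteq> H" using \<rho> by blast
    ultimately have "\<exists>s\<in>H. \<forall>r\<in>\<rho> ` \<A>. r \<le>\<^sup>* s"
      using dir[unfolded lt_directed_def, rule_format, of "\<rho> ` \<A>"] by simp
    then obtain s where s: "s \<in> H" and ub: "\<And>A. A \<in> \<A> \<Longrightarrow> \<rho> A \<le>\<^sup>* s" by auto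
    have Us: "U A \<in> fil s" if "A \<in> \<A>" for A
    proof -
      have "fil (\<rho> A) \<subseteq> fil s" using ub[OF that] unfolding le_star_def .
      then show ?thesis using \<rho>[OF that] by (rule subsetD[OF _ conjunct2])
    qed
    have sQ: "s \<in> Qstar \<F>" and sF: "s \<subseteq> \<F>" using s HQ by (auto simp: Qstar_def)
    have "\<forall>A\<in>\<A>. \<exists>\<epsilon>. \<forall>\<alpha> Z F. (\<alpha>, Z, F) \<in> s \<longrightarrow> \<epsilon> \<le> \<alpha> \<longrightarrow> U A \<inter> Z \<in> F"
      using fil_eventually[OF Us] by (rule ballI)
    then obtain \<epsilon> where \<epsilon>: "\<And>A \<alpha> Z F. A \<in> \<A> \<Longrightarrow> (\<alpha>, Z, F) \<in> s \<Longrightarrow> \<epsilon> A \<le> \<alpha> \<Longrightarrow> U A \<inter> Z \<in> F"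
      by metis
    have "|\<A>| <o |UNIV :: 'a set|"
      using small kle ordLess_ordLeq_trans ordLess_UNIV_iff by blast
    \<comment> \<open>A single threshold serves all \<open>A\<close> at once: there are fewer than
      \<lambda> of them and \<lambda> is regular.\<close>
    then obtain b where b: "\<And>A. A \<in> \<A> \<Longrightarrow> \<epsilon> A < b" using image_bounded by blast
    obtain h where h: "\<And>\<alpha> Z F z. (\<alpha>, Z, F) \<in> s \<Longrightarrow> z \<in> Z \<Longrightarrow> z < h \<alpha>"
      using Qstar_support_bound[OF sys sQ] by blast
    \<comment> \<open>Closure under \<open>g\<close> puts \<open>C\<close> inside the range of
      \<open>e\<close>; closure under \<open>h\<close> keeps each \<open>Z\<close> that starts below
      a point of \<open>C\<close> entirely below it.\<close>
    define C where "C = closure_points (\<lambda>x. max (g x) (h x))"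
    have Ce: "C \<subseteq> range e" unfolding e C_def closure_points_def by auto
    \<comment> \<open>Each interval lies in the block with the same left end, so the blocks starting
      in \<open>C\<close> already have their union in \<open>?D\<close>.\<close>
    have "(\<Union>\<delta>\<in>C. {\<delta>..<g \<delta>}) \<in> ?D"
      unfolding C_def by (rule big[OF club_closure_points])
    moreover have "(\<Union>\<delta>\<in>C. {\<delta>..<g \<delta>}) \<subseteq> U (e -` C)"
    proof
      fix y assume "y \<in> (\<Union>\<delta>\<in>C. {\<delta>..<g \<delta>})"
      then obtain \<delta> where \<delta>: "\<delta> \<in> C" "y \<in> {\<delta>..<g \<delta>}" by blast
      then obtain \<xi> where "\<delta> = e \<xi>" using Ce by blast
      then show "y \<in> U (e -` C)"
        unfolding UI using \<delta> closure_points_block[OF e, of \<xi>] by (intro bexI[of _ \<xi>]) auto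
    qed
    ultimately have UC: "U (e -` C) \<in> ?D"
      using proper_filter_onD(4)[OF pf] by blast
    show "\<Inter>\<A> \<in> {A. U A \<in> ?D}"
    proof (rule ccontr)
      assume "\<Inter>\<A> \<notin> {A. U A \<in> ?D}"
      then have "UNIV - \<Inter>\<A> \<in> {A. U A \<in> ?D}"
        using quot unfolding ultrafilter_on_def by blast
      then have "(UNIV - \<Inter>\<A>) \<inter> e -` C \<in> {A. U A \<in> ?D}"
        using quot UC unfolding ultrafilter_on_def proper_filter_on_def by blast
      then have X: "U (e -` C - \<Inter>\<A>) \<in> ?D" (is "?X \<in> _") by (simp add: Diff_eq Int_commute)
      obtain \<alpha> Z F where t: "(\<alpha>, Z, F) \<in> s" "b \<le> \<alpha>" "Z - ?X \<notin> F"
        using fil_positive[OF s pf X] by blast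
      have pZ: "proper_filter_on Z F"
        using t(1) sF sys unfolding local_filter_system_def by blast
      have "Z - ?X \<noteq> Z" using t(3) proper_filter_onD(1)[OF pZ] by metis
      then obtain z \<xi> where z: "z \<in> Z" "z \<in> {e \<xi>..<e (ord_succ \<xi>)}" "e \<xi> \<in> C" "\<xi> \<notin> \<Inter>\<A>"
        unfolding U_def by blast
      \<comment> \<open>A point of \<open>C\<close> is not straddled by \<open>Z\<close>, so \<open>e \<xi>\<close> is the only point of \<open>C\<close> whose block meets \<open>Z\<close>.\<close>
      have start: "e \<eta> \<le> \<alpha>" if "y \<in> Z" "e \<eta> \<le> y" "e \<eta> \<in> C" for y \<eta>
      proof (rule ccontr)
        assume "\<not> e \<eta> \<le> \<alpha>"
        then have "h \<alpha> < e \<eta>" using that(3) unfolding C_def closure_points_def by auto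
        then show False using h[OF t(1) that(1)] that(2) by simp
      qed
      have "\<alpha> \<le> y" if "y \<in> Z" for y
        using local_filter_min[OF sys] t(1) sF that by blast
      \<comment> \<open>Both blocks contain \<alpha>: each starts at or below \<alpha> and contains
        a point of \<open>Z\<close>, which is at least \<alpha>.\<close>
      then have only: "\<eta> = \<xi>" if "y \<in> Z" "y \<in> {e \<eta>..<e (ord_succ \<eta>)}" "e \<eta> \<in> C" for y \<eta>
        using that z start[of y \<eta>] start[of z \<xi>]
        by (intro block_index_unique[OF e(1), of \<alpha>]) fastforce+
      obtain A where A: "A \<in> \<A>" "\<xi> \<notin> A" using z(4) by blast
      \<comment> \<open>This set avoids \<open>?X\<close>: the only block of \<open>?X\<close> that
        meets \<open>Z\<close> has index \<xi>, which is not in \<open>A\<close>. Hence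
        \<open>Z - ?X\<close> would be in \<open>F\<close>.\<close>
      have "U A \<inter> Z \<in> F" using \<epsilon> A(1) t(1,2) b by (meson less_imp_le order_trans)
      moreover have "U A \<inter> Z \<subseteq> Z - ?X"
      proof
        fix y assume y: "y \<in> U A \<inter> Z"
        then obtain \<zeta> where \<zeta>: "\<zeta> \<in> A" "y \<in> {e \<zeta>..<e (ord_succ \<zeta>)}" unfolding UI Int_iff by blast
        have "y \<notin> ?X"
        proof
          assume "y \<in> ?X"
          then obtain \<eta> where \<eta>: "e \<eta> \<in> C" "y \<in> {e \<eta>..<e (ord_succ \<eta>)}" unfolding UI Int_iff by blast
          then have "\<eta> = \<xi>" using only y by blast
          moreover have "\<zeta> = \<eta>" using block_index_unique[OF e(1) \<zeta>(2) \<eta>(2)] .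
          ultimately show False using \<zeta>(1) A(2) by blast
        qed
        then show "y \<in> Z - ?X" using y by blast
      qed
      ultimately show False using t(3) proper_filter_onD(4)[OF pZ] by blast
    qed
  qed
qed

text \<open>\<open>E\<close> consists of indices, so \<open>big\<close> is applied to its image
  under \<open>e\<close>, a club of points; each interval then grows to a full block.\<close>

lemma club_in_quotient:
  fixes e g :: "'a \<Rightarrow> 'a"
  assumes pf: "proper_filter_on UNIV D"
    and big: "\<And>C. club C \<Longrightarrow> (\<Union>\<delta>\<in>C. {\<delta>..<g \<delta>}) \<in> D"
    and e: "strict_mono e" "range e = closure_points g" and E: "club E"
  shows "(\<Union>\<xi>\<in>E. {e \<xi>..<e (ord_succ \<xi>)}) \<in> D"
proof -
  have "club (e ` E)"
    using club_image_enum[OF e(1) _ E] club_closure_points[of g] e(2) by simp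
  then have *: "(\<Union>\<xi>\<in>E. {e \<xi>..<g (e \<xi>)}) \<in> D"
    using big by fastforce
  show ?thesis
    using closure_points_block[OF e]
    by (intro proper_filter_onD(4)[OF pf *]) (fastforce intro: order.strict_trans)+
qed

end

section \<open>The club obtained from a failure of weak reasonableness\<close>

theorem theorem1p9:
  fixes \<F> :: "'a::wellorder local_filter set"
    and H :: "'a local_filter set set"
    and \<kappa> :: "'b rel"
  assumes "Card_order (ord_rel :: 'a rel)"
    and "regularCard (ord_rel :: 'a rel)"
    and "natLeq <o (ord_rel :: 'a rel)"
    and "local_filter_system \<F>"
    and "Card_order \<kappa>" and "\<kappa> \<le>o (ord_rel :: 'a rel)"
    and "H \<subseteq> Qstar \<F>"
    and "lt_directed \<kappa> H"
    and "ultrafilter_on UNIV (fil_family H)"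
    and "\<not> weakly_reasonable (fil_family H)"
  shows "\<exists>C. club C \<and>
           ultrafilter_on UNIV (quotient_filter (fil_family H) C) \<and>
           lt_complete \<kappa> (quotient_filter (fil_family H) C) \<and>
           (\<forall>E. club E \<longrightarrow> E \<in> quotient_filter (fil_family H) C)"
proof -
  let ?D = "fil_family H"
  note lam = assms(1-3)
  \<comment> \<open>Given uniformity, weak reasonableness can fail only through some function
    \<open>f\<close>.\<close>
  have "uniform_ultrafilter ?D"
    unfolding uniform_ultrafilter_def
    using assms(9) fil_family_uniform[OF lam assms(4,7)] by blast
  then obtain f :: "'a \<Rightarrow> 'a"
    where f: "\<And>C. club C \<Longrightarrow> (\<Union>\<delta>\<in>C. {\<delta>..<ord_add \<delta> (f \<delta>)}) \<in> ?D"
    using assms(10) unfolding weakly_reasonable_def by blast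
  define g where "g \<delta> = ord_add \<delta> (f \<delta>)" for \<delta>
  have big: "\<And>C. club C \<Longrightarrow> (\<Union>\<delta>\<in>C. {\<delta>..<g \<delta>}) \<in> ?D"
    using f by (simp add: g_def)
  define C where "C = closure_points g"
  have club: "club C" unfolding C_def by (rule club_closure_points[OF lam])
  have zero: "ord_zero \<in> C" unfolding C_def by (rule ord_zero_in_closure_points)
  define e where "e = increasing_enum C"
  have e: "strict_mono e" "range e = C"
    using increasing_enum_props[OF lam, of C] club unfolding e_def club_def by blast+
  \<comment> \<open>Since \<open>ord_zero\<close> is in \<open>C\<close>, adjoining it in
    \<open>quotient_filter\<close> changes nothing.\<close>
  have Q: "quotient_filter ?D C = {A. (\<Union>\<xi>\<in>A. {e \<xi>..<e (ord_succ \<xi>)}) \<in> ?D}"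
    unfolding quotient_filter_def e_def using zero by (simp add: Let_def insert_absorb)
  have pf: "proper_filter_on UNIV ?D"
    using assms(9) by (simp add: ultrafilter_on_def)
  have "ultrafilter_on UNIV (quotient_filter ?D C)"
    unfolding Q using ultrafilter_quotient[OF lam e(1)] club zero assms(9) e(2) by blast
  moreover have "lt_complete \<kappa> (quotient_filter ?D C)"
    unfolding Q using lt_complete_quotient[OF lam assms(4,6-9) big e(1)] e(2) C_def by blast
  moreover have "\<forall>E. club E \<longrightarrow> E \<in> quotient_filter ?D C"
    unfolding Q using club_in_quotient[OF lam pf big e(1)] e(2) C_def by blast
  ultimately show ?thesis using club by blast
qed

end
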